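(* Let $n\ge 2$ and let $p(z)=\sum_{j=0}^n a_jz^j$ be a polynomial with $a_j\in\mathbb{C}$ and $a_n=1$. Let $d_1,d_2,\ldots,d_n$ be arbitrary strictly positive real constants, and define $$\alpha_1=\frac{1}{d_1}\left[\frac{d_1}{2}\Big(|a_{n-1}|+\sum_{i=0}^{n-1}|a_i|\Big)+\frac{d_2}{2}\right],$$ $$\alpha_k=\frac{1}{d_k}\left[\frac{d_1}{2}|a_{n-k}|+\frac{d_k}{2}+\frac{d_{k+1}}{2}\right]\quad (2\le k\le n-1),$$ $$\alpha_{n}=\frac{1}{d_n}\left[\frac{d_1}{2}|a_{0}|+\frac{d_n}{2}\right].$$ If $\mu$ is a zero of $p(z)$, then $$|\mu| \leq \max \{\alpha_1, \alpha_2, \ldots, \alpha_n\}.$$ *)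

theory Defs
  imports Complex_Main "HOL-Computational_Algebra.Polynomial"
begin

text \<open>
  The quantities \<open>\<alpha>\<^sub>1, \<dots>, \<alpha>\<^sub>n\<close>, for coefficients \<open>a 0, \<dots>, a n\<close> and weights
  \<open>d 1, \<dots>, d n\<close>. They are meant for \<open>n \<ge> 2\<close> and \<open>1 \<le> k \<le> n\<close>, where the three cases
  are disjoint and exhaustive.
\<close>

definition alpha :: "nat \<Rightarrow> (nat \<Rightarrow> complex) \<Rightarrow> (nat \<Rightarrow> real) \<Rightarrow> nat \<Rightarrow> real" where
  "alpha n a d k =
    (if k = 1 then
       1 / d 1 * (d 1 / 2 * (cmod (a (n - 1)) + (\<Sum>i = 0..n - 1. cmod (a i))) + d 2 / 2)
     else if k = n then
       1 / d n * (d 1 / 2 * cmod (a 0) + d n / 2)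
     else
       1 / d k * (d 1 / 2 * cmod (a (n - k)) + d k / 2 + d (k + 1) / 2))"

end

theory Submission
  imports Defs
begin

text \<open>
  Put \<open>b k = \<bar>a (n - k)\<bar>\<close>, let \<open>M\<close> be the maximum of the \<open>\<alpha> k\<close>, and \<open>d (n + 1) = 0\<close>. Each
  \<open>2 * \<alpha> k\<close> is \<open>r k + c k\<close>, where \<open>r k\<close> is the \<open>k\<close>-th absolute row sum of the companion matrix \<open>C\<close>
  (\<open>r k = 1\<close> for \<open>k \<ge> 2\<close>) and \<open>c k = (b k * d 1 + d (k + 1)) / d k\<close> is the \<open>k\<close>-th absolute column
  sum of \<open>D C D\<inverse>\<close>, \<open>D = diag(d 1, \<dots>, d n)\<close>. For \<open>k \<ge> 2\<close>, \<open>1 + c k \<le> 2 M\<close> gives \<open>c k \<le> M\<^sup>2\<close>;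
  these inequalities telescope to \<open>c 1 \<ge> (\<Sum>k. b k / M ^ (2 * k - 2))\<close>. Together with
  \<open>r 1 + c 1 \<le> 2 M\<close> and the inequality of arithmetic and geometric means this yields
  \<open>(\<Sum>k. b k / M ^ k) \<le> 1\<close>, which is Cauchy's criterion for \<open>M\<close> to bound all zeros.
\<close>

text \<open>If \<open>m = cmod \<mu>\<close> exceeded \<open>M\<close>, the leading term
  \<open>m ^ n\<close> would strictly dominate the sum of the others.\<close>

lemma cauchy_root_bound:
  fixes a :: "nat \<Rightarrow> complex" and \<mu> :: complex and M :: real
  assumes root: "(\<Sum>j = 0..n. a j * \<mu> ^ j) = 0" and monic: "a n = 1" and M: "M > 0"
    and le: "(\<Sum>k = 1..n. cmod (a (n - k)) / M ^ k) \<le> 1"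
  shows "cmod \<mu> \<le> M"
proof (rule ccontr)
  assume "\<not> cmod \<mu> \<le> M"
  define m where "m = cmod \<mu>"
  have m: "m > M" "m > 0" using \<open>\<not> cmod \<mu> \<le> M\<close> M by (auto simp: m_def)
  have "(\<Sum>j<n. a j * \<mu> ^ j) + \<mu> ^ n = 0"
    using root monic by (simp add: atLeast0AtMost lessThan_Suc_atMost[symmetric])
  then have "\<mu> ^ n = - (\<Sum>j<n. a j * \<mu> ^ j)"
    by (simp add: eq_neg_iff_add_eq_0 add.commute)
  then have "m ^ n = cmod (\<Sum>j<n. a j * \<mu> ^ j)"
    by (metis m_def norm_minus_cancel norm_power)
  also have "\<dots> \<le> (\<Sum>j<n. cmod (a j) * m ^ j)"
    by (rule sum_norm_le) (simp add: norm_mult norm_power m_def)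
  also have "\<dots> = (\<Sum>k = 1..n. cmod (a (n - k)) * m ^ (n - k))"
    by (rule sum.reindex_bij_witness[of _ "\<lambda>k. n - k" "\<lambda>k. n - k"]) auto
  also have "\<dots> = m ^ n * (\<Sum>k = 1..n. cmod (a (n - k)) / m ^ k)"
    unfolding sum_distrib_left using m by (intro sum.cong) (auto simp: power_diff)
  finally have "1 \<le> (\<Sum>k = 1..n. cmod (a (n - k)) / m ^ k)"
    using m by simp
  \<comment> \<open>As \<open>k \<ge> 1\<close>, a factor \<open>M / m < 1\<close> splits off every
    term; it supplies the strictness.\<close>
  also have "\<dots> \<le> (\<Sum>k = 1..n. M / m * (cmod (a (n - k)) / M ^ k))"
  proof (rule sum_mono)
    fix k assume "k \<in> {1..n}"
    then obtain l where k: "k = Suc l" by (cases k) auto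
    have "1 / m ^ l \<le> 1 / M ^ l"
      using m M by (intro divide_left_mono power_mono) auto
    then have "cmod (a (n - k)) / m * (1 / m ^ l) \<le> cmod (a (n - k)) / m * (1 / M ^ l)"
      using m by (intro mult_left_mono) auto
    then show "cmod (a (n - k)) / m ^ k \<le> M / m * (cmod (a (n - k)) / M ^ k)"
      using M by (simp add: k)
  qed
  also have "\<dots> = M / m * (\<Sum>k = 1..n. cmod (a (n - k)) / M ^ k)"
    by (simp only: sum_distrib_left)
  also have "\<dots> \<le> M / m * 1"
    using le M m by (intro mult_left_mono) auto
  also have "\<dots> < 1" using m by simp
  finally show False by simp
qed

text \<open>The hypothesis times \<open>y ^ (l - 1)\<close> trades the remainder
  \<open>d (Suc l) * y ^ (l - 1)\<close> for the next summand plus the next remainder.\<close>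

lemma telescoping_sum_bound:
  fixes b d :: "nat \<Rightarrow> real" and y :: real
  assumes y: "y \<ge> 0"
    and step: "\<And>k. k \<in> {2..n} \<Longrightarrow> y * (b k + d (Suc k)) \<le> d k"
    and "1 \<le> n"
  shows "(\<Sum>k = 1..n. b k * y ^ (k - 1)) + d (Suc n) * y ^ (n - 1) \<le> b 1 + d 2"
  using \<open>1 \<le> n\<close> step
proof (induction n rule: dec_induct)
  case base
  then show ?case by (simp add: numeral_2_eq_2)
next
  case (step l)
  have "y ^ (l - 1) * (y * (b (Suc l) + d (Suc (Suc l)))) \<le> y ^ (l - 1) * d (Suc l)"
    using y step by (intro mult_left_mono) auto
  moreover have "y ^ l = y ^ (l - 1) * y"
    using \<open>1 \<le> l\<close> by (cases l) auto
  moreover have "(\<Sum>k = 1..l. b k * y ^ (k - 1)) + d (Suc l) * y ^ (l - 1) \<le> b 1 + d 2"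
    using step by auto
  ultimately show ?case by (simp add: algebra_simps)
qed

theorem theorem7:
  fixes n :: nat
    and a :: "nat \<Rightarrow> complex"
    and p :: "complex poly"
    and d :: "nat \<Rightarrow> real"
    and \<mu> :: complex
  assumes "n \<ge> 2"
    and "p = (\<Sum>j = 0..n. monom (a j) j)"
    and "a n = 1"
    and "\<And>k. k \<in> {1..n} \<Longrightarrow> d k > 0"
    and "poly p \<mu> = 0"
  shows "cmod \<mu> \<le> Max (alpha n a d ` {1..n})"
proof -
  define M where "M = Max (alpha n a d ` {1..n})"
  define b where "b k = cmod (a (n - k))" for k
  \<comment> \<open>Scaled so that \<open>e 1 = 1\<close>; the value 0 beyond \<open>n\<close>
    merges the case \<open>k = n\<close> with the middle ones.\<close>
  define e where "e k = (if k \<le> n then d k / d 1 else 0)" for k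
  define S where "S = (\<Sum>k = 1..n. b k)"
  have d1: "d 1 > 0" using assms(1,4) by auto
  have le_M: "alpha n a d k \<le> M" if "k \<in> {1..n}" for k
    unfolding M_def using that by (intro Max_ge) auto
  have S_eq: "(\<Sum>i = 0..n - 1. cmod (a i)) = S"
    unfolding S_def b_def using assms(1)
    by (intro sum.reindex_bij_witness[of _ "\<lambda>k. n - k" "\<lambda>k. n - k"]) auto
  have "d n > 0" using assms(1,4) by auto
  then have "0 < alpha n a d n"
    using d1 assms(1) by (simp add: alpha_def add_nonneg_pos)
  then have M: "M > 0" using le_M[of n] assms(1) by auto
  have row1: "S + (b 1 + e 2) \<le> 2 * M"
    using le_M[of 1] assms(1) d1 by (simp add: alpha_def S_eq[unfolded One_nat_def] b_def e_def field_simps)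
  have "(1 / M\<^sup>2) * (b k + e (Suc k)) \<le> e k" if k: "k \<in> {2..n}" for k
  proof -
    have dk: "d k > 0" using assms(4) k by auto
    then have ek: "e k > 0" using k d1 by (simp add: e_def)
    have "2 * alpha n a d k = 1 + (b k + e (Suc k)) / e k"
      using k d1 dk by (auto simp: alpha_def b_def e_def field_simps)
    then have "(b k + e (Suc k)) / e k \<le> 2 * M - 1"
      using le_M[of k] k by auto
    also have "\<dots> \<le> M\<^sup>2"
      using zero_le_power2[of "M - 1"] by (simp add: power2_diff)
    finally show ?thesis using ek M by (simp add: field_simps)
  qed
  then have "(\<Sum>k = 1..n. b k * (1 / M\<^sup>2) ^ (k - 1)) + e (Suc n) * (1 / M\<^sup>2) ^ (n - 1) \<le> b 1 + e 2"
    using assms(1) by (intro telescoping_sum_bound) auto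
  then have col1: "(\<Sum>k = 1..n. b k * (1 / M\<^sup>2) ^ (k - 1)) \<le> b 1 + e 2"
    by (simp add: e_def)
  have "2 * M * (\<Sum>k = 1..n. b k / M ^ k) \<le> (\<Sum>k = 1..n. b k + b k * (1 / M\<^sup>2) ^ (k - 1))"
    unfolding sum_distrib_left
  proof (rule sum_mono)
    fix k assume "k \<in> {1..n}"
    then obtain l where k: "k = Suc l" by (cases k) auto
    \<comment> \<open>AM-GM for \<open>1\<close> and \<open>1 / M ^ (2 * l)\<close>, the weights of
      \<open>b k\<close> in row and column sums.\<close>
    have "2 * (1 / M ^ l) \<le> 1 + (1 / M\<^sup>2) ^ l"
      using zero_le_power2[of "1 - 1 / M ^ l"]
      by (simp add: power2_diff power_divide power_mult[symmetric] mult.commute)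
    then have "b k * (2 * (1 / M ^ l)) \<le> b k * (1 + (1 / M\<^sup>2) ^ l)"
      by (intro mult_left_mono) (auto simp: b_def)
    then show "2 * M * (b k / M ^ k) \<le> b k + b k * (1 / M\<^sup>2) ^ (k - 1)"
      using M by (simp add: k algebra_simps)
  qed
  also have "\<dots> \<le> 2 * M"
    using row1 col1 by (simp add: sum.distrib S_def)
  finally have "(\<Sum>k = 1..n. cmod (a (n - k)) / M ^ k) \<le> 1"
    using M by (simp add: b_def)
  moreover have "(\<Sum>j = 0..n. a j * \<mu> ^ j) = 0"
    using assms(2,5) by (simp add: poly_sum poly_monom)
  ultimately show ?thesis
    using cauchy_root_bound[of a \<mu> n M] assms(3) M by (simp add: M_def)
qed

end
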